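(* If $G$ is a finite chordal graph such that the independence complex $\mathrm{Ind}(G)$ is contractible, then either $G$ is a single vertex or $G$ has a good pair, i.e. a pair $(x,y)$ of distinct vertices with $N_G(x)\subseteq N_G(y)$.
   Context: A graph is chordal if it has no induced cycle of length more than three. $\mathrm{Ind}(G)$ is the simplicial complex on $V(G)$ whose faces are the independent sets of $G$. $N_G(x)=\{w : xw\in E(G)\}$ is the open neighbourhood of $x$. *)

theory Defs
  imports "HOL-Analysis.Analysis"
begin

definition finite_simple_graph :: "'a set \<Rightarrow> 'a set set \<Rightarrow> bool" where
  "finite_simple_graph V E \<longleftrightarrow> finite V \<and> (\<forall>e\<in>E. e \<subseteq> V \<and> card e = 2)"

definition open_nbhd :: "'a set set \<Rightarrow> 'a \<Rightarrow> 'a set" where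
  "open_nbhd E x = {w. {x, w} \<in> E}"

text \<open>A cycle is given by the list of its vertices in cyclic order; ``induced'' means that
  two of its vertices are adjacent in the graph only if they are consecutive on the cycle.\<close>

definition induced_cycle :: "'a set \<Rightarrow> 'a set set \<Rightarrow> 'a list \<Rightarrow> bool" where
  "induced_cycle V E c \<longleftrightarrow>
     3 \<le> length c \<and> distinct c \<and> set c \<subseteq> V \<and>
     (\<forall>i<length c. \<forall>j<length c.
        {c ! i, c ! j} \<in> E \<longleftrightarrow> j = Suc i mod length c \<or> i = Suc j mod length c)"

definition chordal :: "'a set \<Rightarrow> 'a set set \<Rightarrow> bool" where
  "chordal V E \<longleftrightarrow> \<not> (\<exists>c. induced_cycle V E c \<and> 3 < length c)"

definition Ind :: "'a set \<Rightarrow> 'a set set \<Rightarrow> 'a set set" where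
  "Ind V E = {S. S \<subseteq> V \<and> (\<forall>u\<in>S. \<forall>v\<in>S. {u, v} \<notin> E)}"

text \<open>Points are given by barycentric coordinates, extended by zero to all of the ambient type.
  For complexes with finitely many vertices the topology induced from the product topology
  is the usual (weak) topology.\<close>

definition geometric_realization :: "'a set set \<Rightarrow> ('a \<Rightarrow> real) topology" where
  "geometric_realization K =
     subtopology (powertop_real UNIV)
       {t. (\<forall>v. 0 \<le> t v) \<and> {v. t v \<noteq> 0} \<in> K \<and> (\<Sum>v | t v \<noteq> 0. t v) = 1}"

text \<open>In the library the empty space satisfies \<^const>\<open>contractible_space\<close>; the usual notion
  (homotopy equivalent to a point) excludes it.\<close>

definition contractible_complex :: "'a set set \<Rightarrow> bool" where
  "contractible_complex K \<longleftrightarrow>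
     topspace (geometric_realization K) \<noteq> {} \<and> contractible_space (geometric_realization K)"

definition good_pair :: "'a set \<Rightarrow> 'a set set \<Rightarrow> 'a \<Rightarrow> 'a \<Rightarrow> bool" where
  "good_pair V E x y \<longleftrightarrow>
     x \<in> V \<and> y \<in> V \<and> x \<noteq> y \<and> open_nbhd E x \<subseteq> open_nbhd E y"

end

theory Submission
  imports Defs "HOL-Homology.Brouwer_Degree"
begin

text \<open>
  If \<open>s\<close> and \<open>w\<close> are adjacent with \<open>N[s] \<subseteq> N[w]\<close>, then a simplicial retraction of
  \<open>Ind(G - N[w])\<close> onto the boundary of a cross-polytope extends to a retraction of \<open>Ind(G)\<close> onto
  its suspension with apexes \<open>s\<close> and \<open>w\<close>: send \<open>N[w] - {w}\<close> to \<open>s\<close>. Call \<open>G\<close> spherical if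
  iterating this step reaches the empty graph; then \<open>Ind(G)\<close> retracts onto a sphere and is not
  contractible. So it suffices to show that a chordal graph without isolated vertices and good
  pairs is spherical.

  This goes by induction on the number of vertices. Let \<open>L\<close> be the set of simplicial vertices and
  \<open>p\<close> a simplicial vertex of \<open>G - L\<close>, with closed neighbourhood \<open>M\<close> there. Let \<open>D\<close> be the set of
  those vertices of \<open>L\<close> whose neighbours outside \<open>L\<close> lie in \<open>M\<close>, let \<open>R = V - M - D\<close>, and let
  \<open>T \<subseteq> M\<close> be the part of \<open>M\<close> with neighbours outside \<open>M \<union> L\<close>. Attaching two new adjacent
  vertices to the clique \<open>T\<close> of \<open>R \<union> T\<close>, or to the clique of those vertices of \<open>T\<close> that have a
  neighbour in \<open>D\<close>, gives smaller graphs to which the induction hypothesis applies unless a vertex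
  of \<open>T\<close> is simplicial in \<open>R \<union> T\<close>; in each case sphericity is transported back to \<open>G\<close>.
\<close>

subsection \<open>Spherical graphs\<close>

definition closed_nbhd :: "('a \<Rightarrow> 'a \<Rightarrow> bool) \<Rightarrow> 'a \<Rightarrow> 'a set" where
  "closed_nbhd A x = {y. y = x \<or> A x y}"

definition clique :: "('a \<Rightarrow> 'a \<Rightarrow> bool) \<Rightarrow> 'a set \<Rightarrow> bool" where
  "clique A T \<longleftrightarrow> (\<forall>u\<in>T. \<forall>v\<in>T. u \<noteq> v \<longrightarrow> A u v)"

definition simplicial :: "('a \<Rightarrow> 'a \<Rightarrow> bool) \<Rightarrow> 'a set \<Rightarrow> 'a \<Rightarrow> bool" where
  "simplicial A V s \<longleftrightarrow> s \<in> V \<and> clique A {v \<in> V. A s v}"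

text \<open>For a finite graph this is chordality, in a form that is easier to check after
  \<open>attach\<close> than a condition on cycles.\<close>

definition hereditarily_simplicial :: "('a \<Rightarrow> 'a \<Rightarrow> bool) \<Rightarrow> 'a set \<Rightarrow> bool" where
  "hereditarily_simplicial A V \<longleftrightarrow> (\<forall>W\<subseteq>V. W \<noteq> {} \<longrightarrow> (\<exists>s. simplicial A W s))"

text \<open>The requirement of a neighbour excludes the one-vertex graph, which has no good pair and
  a contractible independence complex.\<close>

definition good_pair_free :: "('a \<Rightarrow> 'a \<Rightarrow> bool) \<Rightarrow> 'a set \<Rightarrow> bool" where
  "good_pair_free A V \<longleftrightarrow>
     (\<forall>x\<in>V. (\<exists>y\<in>V. A x y) \<and> (\<forall>y\<in>V. y \<noteq> x \<longrightarrow> (\<exists>z\<in>V. A x z \<and> \<not> A y z)))"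

inductive spherical :: "('a \<Rightarrow> 'a \<Rightarrow> bool) \<Rightarrow> 'a set \<Rightarrow> bool" for A where
  empty: "spherical A {}"
| suspend: "\<lbrakk>s \<in> V; w \<in> V; A s w; \<And>v. v \<in> V \<Longrightarrow> A s v \<Longrightarrow> v \<in> closed_nbhd A w;
     spherical A (V - closed_nbhd A w)\<rbrakk> \<Longrightarrow> spherical A V"

lemma spherical_cong:
  assumes "spherical A V" "\<And>u v. u \<in> V \<Longrightarrow> v \<in> V \<Longrightarrow> A u v = B u v"
  shows "spherical B V"
  using assms
proof (induction rule: spherical.induct)
  case empty
  show ?case by (rule spherical.empty)
next
  case (suspend s V w)
  have eq: "V - closed_nbhd B w = V - closed_nbhd A w"
    using suspend by (auto simp: closed_nbhd_def)
  show ?case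
  proof (rule spherical.suspend[of s _ w])
    show "spherical B (V - closed_nbhd B w)" unfolding eq
      by (rule suspend.IH) (use suspend.prems in auto)
    show "v \<in> closed_nbhd B w" if "v \<in> V" "B s v" for v
      using suspend.hyps(1-4) suspend.prems that by (auto simp: closed_nbhd_def)
  qed (use suspend in auto)
qed

lemma hereditarily_simplicial_subset:
  "hereditarily_simplicial A V \<Longrightarrow> W \<subseteq> V \<Longrightarrow> hereditarily_simplicial A W"
  unfolding hereditarily_simplicial_def by blast

lemma simplicialD:
  "simplicial A V s \<Longrightarrow> u \<in> V \<Longrightarrow> v \<in> V \<Longrightarrow> A s u \<Longrightarrow> A s v \<Longrightarrow> u \<noteq> v \<Longrightarrow> A u v"
  unfolding simplicial_def clique_def by blast

lemma simplicial_mem: "simplicial A V s \<Longrightarrow> s \<in> V"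
  unfolding simplicial_def by blast

lemma simplicial_subset:
  "simplicial A V s \<Longrightarrow> W \<subseteq> V \<Longrightarrow> s \<in> W \<Longrightarrow> simplicial A W s"
  unfolding simplicial_def clique_def by blast

locale sgraph =
  fixes A :: "'a \<Rightarrow> 'a \<Rightarrow> bool"
  assumes sym: "A u v \<Longrightarrow> A v u" and irr: "\<not> A u u"
begin

text \<open>If a simplicial \<open>v\<close> lies in \<open>T\<close>, then \<open>T - {v}\<close>
  is contained in the clique \<open>N(v)\<close>. Unless the graph is complete, induction on
  \<open>V - {v}\<close> with this clique gives a simplicial vertex not adjacent to
  \<open>v\<close>, which stays simplicial in \<open>V\<close>.\<close>

lemma simplicial_outside_clique:
  assumes "finite V" "hereditarily_simplicial A V" "T \<subseteq> V" "clique A T" "T \<noteq> V"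
  obtains s where "s \<notin> T" "simplicial A V s"
  using assms
proof (induction "card V" arbitrary: V T thesis rule: less_induct)
  case less
  from less.prems have "V \<noteq> {}" by auto
  then obtain v where v: "simplicial A V v"
    using less.prems unfolding hereditarily_simplicial_def by blast
  show ?case
  proof (cases "v \<in> T")
    case False
    then show ?thesis using v less.prems by blast
  next
    case True
    define K where "K = {u \<in> V. A v u}"
    have TK: "T - {v} \<subseteq> K"
      using True less.prems unfolding K_def clique_def by auto
    have vK: "v \<notin> K" unfolding K_def using irr by auto
    have cK: "clique A K" using v unfolding simplicial_def K_def by auto
    show ?thesis
    proof (cases "K = V - {v}")
      case T: True
      obtain s where s: "s \<in> V" "s \<notin> T" using less.prems by auto
      have "A v x" if "x \<in> V" "x \<noteq> v" for x
        using T that unfolding K_def by auto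
      then have "A x y" if "x \<in> V" "y \<in> V" "x \<noteq> y" for x y
        using that simplicialD[OF v] sym by metis
      then have "simplicial A V s"
        using s unfolding simplicial_def clique_def by blast
      then show ?thesis using s less.prems by auto
    next
      case F: False
      have "card (V - {v}) < card V"
        using less.prems simplicial_mem[OF v] by (intro psubset_card_mono) auto
      then obtain s where s: "s \<notin> K" "simplicial A (V - {v}) s"
        using less.hyps[of "V - {v}" K] F cK vK less.prems
          hereditarily_simplicial_subset[of A V "V - {v}"] unfolding K_def by auto
      have "\<not> A s v" using s sym[of s v] simplicial_mem[OF s(2)] unfolding K_def by blast
      then have "{u \<in> V. A s u} = {u \<in> V - {v}. A s u}" by auto
      then have "simplicial A V s" using s unfolding simplicial_def by simp
      moreover have "s \<notin> T" using s TK simplicial_mem[OF s(2)] by auto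
      ultimately show ?thesis using less.prems by auto
    qed
  qed
qed

text \<open>Sphericity can be tested at any simplicial vertex, so it does not depend on the choices made.\<close>

lemma spherical_simplicial:
  assumes "spherical A V" "simplicial A V s"
  shows "\<exists>w\<in>V. A s w \<and> spherical A (V - closed_nbhd A w)"
  using assms
proof (induction arbitrary: s rule: spherical.induct)
  case empty
  then show ?case by (simp add: simplicial_def)
next
  case (suspend s1 V w1)
  note s = simplicial_mem[OF suspend.prems]
  consider "A s w1" | "s = w1" | "s \<notin> closed_nbhd A w1"
    using sym unfolding closed_nbhd_def by blast
  then show ?case
  proof cases
    case 1
    then show ?thesis using suspend by blast
  next
    case 2
    \<comment> \<open>Here \<open>w1\<close> is itself simplicial, so \<open>s1\<close> and
      \<open>w1\<close> are twins and \<open>s1\<close> can serve as \<open>w\<close>.\<close>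
    have "V - closed_nbhd A s1 = V - closed_nbhd A w1"
      using suspend.hyps(1-4) 2 simplicialD[OF suspend.prems] sym
      unfolding closed_nbhd_def by blast
    then show ?thesis using 2 suspend.hyps sym by metis
  next
    case 3
    \<comment> \<open>The two deletions commute: the induction gives \<open>w\<close> for
      \<open>s\<close> outside \<open>N[w1]\<close>, and the suspension by \<open>s1\<close>,
      \<open>w1\<close> is still available in \<open>V - N[w]\<close>.\<close>
    then have "simplicial A (V - closed_nbhd A w1) s"
      using simplicial_subset[OF suspend.prems] s by auto
    from suspend.IH[OF this] obtain w where
      w: "w \<in> V" "w \<notin> closed_nbhd A w1" "A s w"
        "spherical A (V - closed_nbhd A w1 - closed_nbhd A w)" by auto
    have "V - closed_nbhd A w1 - closed_nbhd A w = V - closed_nbhd A w - closed_nbhd A w1"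
      by auto
    with w have sp: "spherical A (V - closed_nbhd A w - closed_nbhd A w1)" by simp
    have "spherical A (V - closed_nbhd A w)"
    proof (rule spherical.suspend[of s1 _ w1, OF _ _ _ _ sp])
      show "w1 \<in> V - closed_nbhd A w"
        using w suspend.hyps sym unfolding closed_nbhd_def by blast
      show "s1 \<in> V - closed_nbhd A w"
        using w suspend.hyps(1-4) sym unfolding closed_nbhd_def by blast
    qed (use suspend.hyps in auto)
    then show ?thesis using w by blast
  qed
qed

lemma spherical_suspend_simplicial:
  assumes "simplicial A V s" "w \<in> V" "A s w" "spherical A (V - closed_nbhd A w)"
  shows "spherical A V"
  using assms simplicialD[OF assms(1,2)]
  by (intro spherical.suspend[of s V w]) (auto simp: closed_nbhd_def simplicial_mem)

text \<open>Combinatorial counterpart of the cofibre sequence of \<open>Ind(G - N[z])\<close>, \<open>Ind(G - z)\<close> and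
  \<open>Ind(G)\<close>.\<close>

lemma spherical_insert_vertex:
  assumes "finite V" "hereditarily_simplicial A V" "z \<in> V"
    "spherical A (V - {z})" "\<not> spherical A (V - closed_nbhd A z)"
  shows "spherical A V"
  using assms
proof (induction "card V" arbitrary: V rule: less_induct)
  case less
  have "V \<noteq> {z}"
  proof
    assume "V = {z}"
    then have "V - closed_nbhd A z = {}" by (auto simp: closed_nbhd_def)
    then show False using less.prems spherical.empty by metis
  qed
  then obtain s where s: "s \<noteq> z" "simplicial A V s"
    using simplicial_outside_clique[of V "{z}"] less.prems by (auto simp: clique_def)
  note sV = simplicial_mem[OF s(2)]
  have "simplicial A (V - {z}) s" using s sV simplicial_subset[of A V s] by auto
  from spherical_simplicial[OF less.prems(4) this] obtain w where
    w: "w \<in> V" "w \<noteq> z" "A s w" "spherical A (V - {z} - closed_nbhd A w)" by auto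
  have "spherical A (V - closed_nbhd A w)"
  proof (cases "A w z")
    case True
    then have "V - {z} - closed_nbhd A w = V - closed_nbhd A w" by (auto simp: closed_nbhd_def)
    then show ?thesis using w by simp
  next
    case False
    then have sz: "\<not> A s z" using simplicialD[OF s(2)] w less.prems by blast
    have e1: "V - closed_nbhd A w - {z} = V - {z} - closed_nbhd A w"
      and e2: "V - closed_nbhd A w - closed_nbhd A z = V - closed_nbhd A z - closed_nbhd A w"
      by auto
    \<comment> \<open>Otherwise suspending with \<open>s\<close> and \<open>w\<close>, neither
      adjacent to \<open>z\<close>, would make \<open>V - N[z]\<close> spherical. So the hypotheses
      pass to \<open>V - N[w]\<close>.\<close>
    have "\<not> spherical A (V - closed_nbhd A w - closed_nbhd A z)"
    proof
      assume "spherical A (V - closed_nbhd A w - closed_nbhd A z)"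
      moreover have "simplicial A (V - closed_nbhd A z) s"
        using s sV sz sym by (intro simplicial_subset[OF s(2)]) (auto simp: closed_nbhd_def)
      ultimately have "spherical A (V - closed_nbhd A z)"
        using spherical_suspend_simplicial[of "V - closed_nbhd A z" s w] w False sym e2
        by (auto simp: closed_nbhd_def)
      then show False using less.prems by simp
    qed
    moreover have "card (V - closed_nbhd A w) < card V"
      using less.prems w by (intro psubset_card_mono) (auto simp: closed_nbhd_def)
    ultimately show ?thesis
      using less.hyps[of "V - closed_nbhd A w"] less.prems w e1 False
        hereditarily_simplicial_subset[of A V "V - closed_nbhd A w"]
      by (auto simp: closed_nbhd_def)
  qed
  then show ?case using spherical_suspend_simplicial s w by blast
qed

text \<open>The vertices of \<open>Z\<close> are inserted one at a time. As \<open>Z\<close> is a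
  clique, deleting \<open>N[z]\<close> removes all those inserted so far, so the set to be
  non-spherical is always \<open>V - N[z]\<close>.\<close>

lemma spherical_insert_clique:
  assumes fin: "finite V" and hs: "hereditarily_simplicial A V" and ZV: "Z \<subseteq> V"
    and cl: "clique A Z" and sp: "spherical A (V - Z)"
    and nsp: "\<And>z. z \<in> Z \<Longrightarrow> \<not> spherical A (V - closed_nbhd A z)"
  shows "spherical A V"
proof -
  have "spherical A (V - Z \<union> Y)" if "finite Y" "Y \<subseteq> Z" for Y
    using that
  proof (induction rule: finite_induct)
    case empty
    then show ?case using sp by simp
  next
    case (insert z Y)
    let ?W = "V - Z \<union> insert z Y"
    have "?W - {z} = V - Z \<union> Y" using insert by auto
    moreover have "?W - closed_nbhd A z = V - closed_nbhd A z"
      using insert.prems ZV cl by (auto simp: closed_nbhd_def clique_def)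
    ultimately show ?case
      using spherical_insert_vertex[of ?W z] insert nsp[of z] fin ZV
        hereditarily_simplicial_subset[OF hs, of ?W] finite_subset[of Y V] by auto
  qed
  from this[of Z] show ?thesis using fin ZV finite_subset by (metis Diff_partition Un_commute subset_refl)
qed

text \<open>Adjacent vertices of \<open>D\<close> are twins, so each suspension at such a pair
  deletes a class of twins along with its neighbours. When \<open>D\<close> is used up, exactly
  \<open>X\<close> remains.\<close>

lemma spherical_attach_twins:
  assumes "finite V" "X \<subseteq> V" "D \<subseteq> V - X" "spherical A X"
    and "\<And>d. d \<in> D \<Longrightarrow> \<exists>d'\<in>D. A d d'"
    and "\<And>d d' v. d \<in> D \<Longrightarrow> d' \<in> D \<Longrightarrow> A d d' \<Longrightarrow> v \<in> V \<Longrightarrow> A d v \<Longrightarrow> v \<in> closed_nbhd A d'"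
    and "\<And>d x. d \<in> D \<Longrightarrow> x \<in> X \<Longrightarrow> \<not> A d x"
    and "\<And>v. v \<in> V - X - D \<Longrightarrow> \<exists>d\<in>D. A d v"
  shows "spherical A V"
  using assms
proof (induction "card V" arbitrary: V D rule: less_induct)
  case less
  show ?case
  proof (cases "D = {}")
    case True
    then have "V = X" using less.prems by blast
    then show ?thesis using less.prems by simp
  next
    case False
    then obtain d where d: "d \<in> D" by auto
    from less.prems(5)[OF d] obtain d' where d': "d' \<in> D" "A d d'" by blast
    let ?V = "V - closed_nbhd A d'" and ?D = "D - closed_nbhd A d'"
    have dV: "d \<in> V" "d' \<in> V" using d d' less.prems by auto
    have "spherical A ?V"
    proof (rule less.hyps[of ?V ?D])
      show "card ?V < card V"
        using less.prems dV by (intro psubset_card_mono) (auto simp: closed_nbhd_def)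
      show "X \<subseteq> ?V"
        using less.prems(2,3) less.prems(7)[OF d'(1)] d' by (auto simp: closed_nbhd_def)
      show "\<exists>e'\<in>?D. A e e'" if e: "e \<in> ?D" for e
      proof -
        from e less.prems(5)[of e] obtain e' where e': "e' \<in> D" "A e e'" by blast
        moreover have "e' \<notin> closed_nbhd A d'"
          using e e' dV less.prems(6)[of e' e d'] sym unfolding closed_nbhd_def by blast
        ultimately show ?thesis by auto
      qed
      show "\<exists>d\<in>?D. A d v" if v: "v \<in> ?V - X - ?D" for v
      proof -
        from v less.prems(8)[of v] obtain e where e: "e \<in> D" "A e v" by auto
        moreover have "e \<notin> closed_nbhd A d'"
          using v e d' less.prems(6)[of e d' v] sym unfolding closed_nbhd_def by blast
        ultimately show ?thesis by auto
      qed
    qed (use less.prems in auto)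
    then show ?thesis
      using d d' dV less.prems(6) by (intro spherical.suspend[of d V d']) auto
  qed
qed

end

subsection \<open>Graphs without good pairs\<close>

text \<open>The vertices in \<open>N\<close> are made adjacent to each other and to \<open>T\<close>; the edges that \<open>A\<close> has at \<open>N\<close>
  are discarded, so that deleted vertices can be reused as new ones.\<close>

definition attach :: "('a \<Rightarrow> 'a \<Rightarrow> bool) \<Rightarrow> 'a set \<Rightarrow> 'a set \<Rightarrow> 'a \<Rightarrow> 'a \<Rightarrow> bool" where
  "attach A T N u v \<longleftrightarrow>
     (u \<notin> N \<and> v \<notin> N \<and> A u v) \<or> (u \<in> N \<and> v \<in> N \<and> u \<noteq> v) \<or>
     (u \<in> N \<and> v \<in> T - N) \<or> (u \<in> T - N \<and> v \<in> N)"

context sgraph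
begin

lemma sgraph_attach: "sgraph (attach A T N)"
  by standard (auto simp: attach_def sym irr)

lemma simplicial_attach:
  assumes "clique A T" "a \<in> N" "a \<in> W"
  shows "simplicial (attach A T N) W a"
  using assms by (auto simp: simplicial_def clique_def attach_def)

text \<open>A vertex of \<open>N\<close> is simplicial in every set containing it, since its
  neighbours lie in the clique \<open>N \<union> T\<close>; away from \<open>N\<close> the relation
  is still \<open>A\<close>.\<close>

lemma hereditarily_simplicial_attach:
  assumes "hereditarily_simplicial A H" "clique A T"
  shows "hereditarily_simplicial (attach A T N) (H \<union> N)"
  unfolding hereditarily_simplicial_def
proof (intro allI impI)
  fix W assume W: "W \<subseteq> H \<union> N" "W \<noteq> {}"
  show "\<exists>s. simplicial (attach A T N) W s"
  proof (cases "W \<inter> N = {}")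
    case True
    then obtain s where "simplicial A W s"
      using W assms unfolding hereditarily_simplicial_def by (metis Int_Un_distrib Un_empty_right inf.orderE inf_le2)
    then have "simplicial (attach A T N) W s"
      using True by (auto simp: simplicial_def clique_def attach_def)
    then show ?thesis ..
  next
    case False
    then show ?thesis using simplicial_attach assms by blast
  qed
qed

text \<open>Adjacent \<open>x\<close> and \<open>y\<close> never form a good pair, the witness being
  \<open>y\<close>. The new vertices separate \<open>T\<close> from \<open>H - T\<close>, and as
  there are two, each is a witness for the other. The assumptions cover the vertices of
  \<open>H - T\<close>.\<close>

lemma good_pair_free_attach:
  assumes "a \<noteq> b" "a \<notin> H" "b \<notin> H" "T \<subseteq> H" "clique A T"
    and "\<And>x. x \<in> H - T \<Longrightarrow> \<exists>z\<in>H - T. A x z"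
    and "\<And>x y. x \<in> H - T \<Longrightarrow> y \<in> H \<Longrightarrow> y \<noteq> x \<Longrightarrow> \<exists>z\<in>H. A x z \<and> \<not> A y z"
  shows "good_pair_free (attach A T {a, b}) (H \<union> {a, b})"
  unfolding good_pair_free_def
proof (intro ballI conjI impI)
  let ?B = "attach A T {a, b}"
  have BH: "?B u v \<longleftrightarrow> A u v" if "u \<in> H" "v \<in> H" for u v
    using that assms(2,3) by (auto simp: attach_def)
  have Ba: "?B u c \<longleftrightarrow> u \<in> T" "?B c u \<longleftrightarrow> u \<in> T" if "u \<in> H" "c \<in> {a, b}" for u c
    using that assms(1-4) by (auto simp: attach_def)
  have Bab: "?B a b" "?B b a" "\<not> ?B c c" for c
    using assms(1) irr by (auto simp: attach_def)
  fix x assume x: "x \<in> H \<union> {a, b}"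
  show "\<exists>y\<in>H \<union> {a, b}. ?B x y"
  proof (cases "x \<in> H - T")
    case True
    then show ?thesis using assms(6)[of x] BH by auto
  next
    case False
    then show ?thesis using x Ba Bab by (metis DiffI UnE UnI2 insertCI insertE singletonD)
  qed
  fix y assume y: "y \<in> H \<union> {a, b}" "y \<noteq> x"
  consider "?B x y" | "x \<in> H - T" "y \<in> H" | "x \<in> H - T" "y \<in> {a, b}"
    | "x \<in> T" "y \<in> H - T" | "x \<in> {a, b}" "y \<in> H - T"
  proof -
    have "?B x y" if "x \<in> T" "y \<in> T"
      using that y assms(4,5) BH unfolding clique_def by (metis subsetD)
    moreover have "?B x y" if "x \<in> {a, b}" "y \<in> T" using Ba that assms(4) by blast
    moreover have "?B x y" if "x \<in> T" "y \<in> {a, b}" using Ba that assms(4) by blast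
    moreover have "?B x y" if "x \<in> {a, b}" "y \<in> {a, b}" using Bab that y by auto
    ultimately show thesis using x y(1) that by (metis DiffI UnE)
  qed
  then show "\<exists>z\<in>H \<union> {a, b}. ?B x z \<and> \<not> ?B y z"
  proof cases
    case 1
    then show ?thesis using y Bab by blast
  next
    case 2
    then show ?thesis using assms(7)[of x y] y BH by auto
  next
    case 3
    then show ?thesis using assms(6)[of x] BH Ba by auto
  next
    case 4
    then show ?thesis using Ba assms(4) by (intro bexI[of _ a]) auto
  next
    case 5
    then show ?thesis using Ba Bab by auto
  qed
qed

text \<open>Sphericity is tested at the simplicial vertex \<open>a\<close>: its neighbour
  \<open>w\<close> is \<open>b\<close> or lies in \<open>T\<close>, and deleting \<open>N[w]\<close>
  removes both new vertices.\<close>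

lemma spherical_attach_cases:
  assumes sp: "spherical (attach A T {a, b}) (H \<union> {a, b})"
    and ab: "a \<noteq> b" "a \<notin> H" "b \<notin> H" and T: "T \<subseteq> H" "clique A T"
  shows "spherical A (H - T) \<or> (\<exists>w\<in>T. spherical A (H - closed_nbhd A w))"
proof -
  let ?B = "attach A T {a, b}"
  have "simplicial ?B (H \<union> {a, b}) a" using simplicial_attach T by auto
  then obtain w where w: "w \<in> H \<union> {a, b}" "?B a w"
    "spherical ?B (H \<union> {a, b} - closed_nbhd ?B w)"
    using sgraph.spherical_simplicial[OF sgraph_attach sp] by blast
  have tr: "spherical A X" if "spherical ?B X" "X \<subseteq> H" for X
    by (rule spherical_cong[OF that(1)]) (use that(2) ab in \<open>auto simp: attach_def\<close>)
  from w consider "w = b" | "w \<in> T" using ab T by (auto simp: attach_def)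
  then show ?thesis
  proof cases
    case 1
    have "H \<union> {a, b} - closed_nbhd ?B b = H - T"
      using ab T by (auto simp: closed_nbhd_def attach_def)
    then show ?thesis using tr w 1 by auto
  next
    case 2
    then have "H \<union> {a, b} - closed_nbhd ?B w = H - closed_nbhd A w"
      using ab T by (auto simp: closed_nbhd_def attach_def)
    then show ?thesis using tr w 2 by auto
  qed
qed

text \<open>Two non-adjacent neighbours of \<open>x\<close> would form an induced 4-cycle with \<open>x\<close> and \<open>y\<close>.\<close>

lemma dominated_imp_simplicial:
  assumes "hereditarily_simplicial A H" "x \<in> H" "y \<in> H" "\<not> A x y" "y \<noteq> x"
    "\<And>z. z \<in> H \<Longrightarrow> A x z \<Longrightarrow> A y z"
  shows "simplicial A H x"
proof (rule ccontr)
  assume "\<not> simplicial A H x"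
  then obtain a b where ab: "a \<in> H" "b \<in> H" "A x a" "A x b" "a \<noteq> b" "\<not> A a b"
    using assms(2) unfolding simplicial_def clique_def by blast
  have yab: "A y a" "A y b" using assms ab by auto
  obtain s where s: "simplicial A {x, a, y, b} s"
    using assms(1,2,3) ab unfolding hereditarily_simplicial_def by (metis empty_subsetI insert_not_empty insert_subset)
  then have "s \<in> {x, a, y, b}" by (rule simplicial_mem)
  then show False
    using simplicialD[OF s] ab yab assms(4,5) sym by blast
qed

end

text \<open>\<open>A\<close> varies in the induction because the smaller graphs carry
  \<open>attach A S {a, b}\<close>. They reuse two vertices outside \<open>H\<close> as
  \<open>a\<close> and \<open>b\<close>; a third vertex outside \<open>H\<close> makes the
  cardinality drop.\<close>

theorem good_pair_free_imp_spherical: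
  assumes "sgraph A" "finite V" "hereditarily_simplicial A V" "good_pair_free A V"
  shows "spherical A V"
  using assms
proof (induction "card V" arbitrary: A V rule: less_induct)
  case less
  interpret sgraph A by (rule less.prems)
  note fin = less.prems(2) and hs = less.prems(3)
  have gp: "\<exists>z\<in>V. A x z \<and> \<not> A y z" if "x \<in> V" "y \<in> V" "y \<noteq> x" for x y
    using less.prems(4) that unfolding good_pair_free_def by blast
  have ni: "\<exists>y\<in>V. A x y" if "x \<in> V" for x
    using less.prems(4) that unfolding good_pair_free_def by blast
  define L where "L = {s. simplicial A V s}"
  have LV: "L \<subseteq> V" unfolding L_def simplicial_def by auto
  have LD: "A u v" if "s \<in> L" "u \<in> V" "v \<in> V" "A s u" "A s v" "u \<noteq> v" for s u v
    using that simplicialD unfolding L_def by fast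
  have twin: "v \<in> closed_nbhd A e" if "d \<in> L" "e \<in> V" "A d e" "v \<in> V" "A d v" for d e v
    using LD[of d e v] that unfolding closed_nbhd_def by blast
  consider "V = {}" | s where "s \<in> L" "\<And>v. v \<in> V \<Longrightarrow> A s v \<Longrightarrow> v \<in> L"
    | "V \<noteq> {}" "\<And>s. s \<in> L \<Longrightarrow> \<exists>v\<in>V - L. A s v"
    by blast
  then show ?case
  proof cases
    case 1
    then show ?thesis using spherical.empty by simp
  next
    case (2 s)
    then obtain w where w: "w \<in> V" "A s w" using ni LV by blast
    have wL: "w \<in> L" using 2 w by blast
    let ?V = "V - closed_nbhd A w"
    \<comment> \<open>\<open>N[w]\<close> is a complete component: all its vertices are simplicial,
      so adjacent ones are twins.\<close>
    have sep: "z \<in> ?V" if "x \<in> ?V" "z \<in> V" "A x z" for x z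
    proof (rule ccontr)
      assume "z \<notin> ?V"
      then have zw: "z = w \<or> A w z" using that by (auto simp: closed_nbhd_def)
      have "z \<in> L"
      proof (cases "z = w \<or> z = s")
        case True
        then show ?thesis using wL 2 by auto
      next
        case False
        then have "A s z" using twin[OF wL, of s z] zw that w sym 2(1) LV
          unfolding closed_nbhd_def by blast
        then show ?thesis using 2 that by blast
      qed
      then show False using twin[of z w x] zw that w sym unfolding closed_nbhd_def by blast
    qed
    have "spherical A ?V"
    proof (rule less.hyps)
      show "card ?V < card V"
        using fin w by (intro psubset_card_mono) (auto simp: closed_nbhd_def)
      show "hereditarily_simplicial A ?V" using hs hereditarily_simplicial_subset by blast
      show "good_pair_free A ?V"
        unfolding good_pair_free_def using gp ni sep by (metis DiffD1)
    qed (use less.prems in auto)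
    then show ?thesis using spherical_suspend_simplicial w 2 unfolding L_def by blast
  next
    case 3
    have "L \<noteq> {}" using 3(1) hs unfolding hereditarily_simplicial_def L_def by blast
    then have "V - L \<noteq> {}" using 3 by blast
    then obtain p where p: "simplicial A (V - L) p"
      using hs unfolding hereditarily_simplicial_def by (metis Diff_subset)
    define M where "M = {v \<in> V - L. v = p \<or> A p v}"
    define D where "D = {s \<in> L. \<forall>v\<in>V - L. A s v \<longrightarrow> v \<in> M}"
    define R where "R = V - M - D"
    define M0 where "M0 = {q \<in> M. \<forall>v\<in>V - L. A q v \<longrightarrow> v \<in> M}"
    define T where "T = M - M0"
    define H where "H = R \<union> T"

    \<comment> \<open>Adjacencies between the parts of \<open>V\<close>\<close>
    have pV: "p \<in> V" "p \<notin> L" using simplicial_mem[OF p] by auto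
    have MV: "M \<subseteq> V" "M \<inter> L = {}" unfolding M_def by auto
    have cM: "A u v" if "u \<in> M" "v \<in> M" "u \<noteq> v" for u v
      using that simplicialD[OF p] sym unfolding M_def by blast
    have pM: "p \<in> M0" "p \<in> M" "p \<notin> T" "p \<notin> R" unfolding T_def R_def M0_def M_def using pV by auto
    have DV: "D \<subseteq> V" "D \<subseteq> L" "D \<inter> M = {}" "D \<inter> R = {}" "M \<inter> R = {}"
      using LV MV unfolding D_def R_def by auto
    have Vdec: "V = R \<union> M \<union> D" using MV DV unfolding R_def by auto
    have TM: "T \<subseteq> M" unfolding T_def by auto
    have cT: "clique A T" using cM TM unfolding clique_def by auto
    \<comment> \<open>Adjacent simplicial vertices are twins, hence have the same neighbours outside
      \<open>L\<close>.\<close>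
    have DL: "e \<in> D" if "d \<in> D" "e \<in> L" "A d e" for d e
    proof -
      have "v \<in> M" if v: "v \<in> V - L" "A e v" for v
      proof -
        have "A d v" using twin[of e d v] that \<open>d \<in> D\<close> \<open>e \<in> L\<close> \<open>A d e\<close> v DV sym
          unfolding closed_nbhd_def by blast
        then show ?thesis using \<open>d \<in> D\<close> v unfolding D_def by blast
      qed
      then show ?thesis using that unfolding D_def by blast
    qed
    have M0L: "e \<in> D" if "q \<in> M0" "e \<in> L" "A q e" for q e
    proof -
      have "v \<in> M" if v: "v \<in> V - L" "A e v" for v
      proof (cases "v = q")
        case True
        then show ?thesis using \<open>q \<in> M0\<close> unfolding M0_def by blast
      next
        case False
        then have "A q v" using LD[of e q v] \<open>q \<in> M0\<close> \<open>e \<in> L\<close> \<open>A q e\<close> v MV sym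
          unfolding M0_def by blast
        then show ?thesis using \<open>q \<in> M0\<close> v unfolding M0_def by blast
      qed
      then show ?thesis using that unfolding D_def by blast
    qed
    \<comment> \<open>So there are no edges between \<open>R\<close> and
      \<open>M0 \<union> D\<close>: \<open>T\<close> separates them.\<close>
    have nbR: "v \<in> H" if "r \<in> R" "v \<in> V" "A r v" for r v
    proof (rule ccontr)
      assume "v \<notin> H"
      then have v: "v \<in> M0 \<or> v \<in> D" using that Vdec unfolding H_def T_def by blast
      have "r \<in> M \<or> r \<in> D"
      proof (cases "r \<in> L")
        case True
        then show ?thesis using v DL M0L that sym by blast
      next
        case False
        then show ?thesis using v that Vdec sym unfolding D_def M0_def by blast
      qed
      then show False using that DV by blast
    qed
    have nbD: "v \<in> M \<or> v \<in> D" if "d \<in> D" "v \<in> V" "A d v" for d v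
      using that DL unfolding D_def by blast
    \<comment> \<open>\<open>q\<close> is not simplicial in \<open>V\<close>, but its neighbours
      outside \<open>L\<close> lie in the clique \<open>M\<close>; so it has a neighbour in
      \<open>L\<close>, which \<open>M0L\<close> puts into \<open>D\<close>.\<close>
    have M0D: "\<exists>d\<in>D. A d q" if "q \<in> M0" for q
    proof -
      have "q \<in> V" "\<not> simplicial A V q" using that MV unfolding M0_def L_def by auto
      then obtain u v where uv: "u \<in> V" "v \<in> V" "A q u" "A q v" "u \<noteq> v" "\<not> A u v"
        unfolding simplicial_def clique_def by blast
      then have "u \<in> L \<or> v \<in> L" using that cM unfolding M0_def by blast
      then show ?thesis using uv M0L that sym by blast
    qed
    \<comment> \<open>The vertex that keeps \<open>d\<close>, \<open>m\<close> from being a good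
      pair cannot lie in the clique \<open>M\<close>, so it lies in \<open>D\<close>.\<close>
    have Dtwin: "\<exists>d'\<in>D. A d d'" if "d \<in> D" "m \<in> M" "\<not> A d m" for d m
    proof -
      have "d \<in> V" "m \<in> V" "m \<noteq> d" using that DV MV by auto
      then obtain z where z: "z \<in> V" "A d z" "\<not> A m z" using gp by blast
      then have "z \<notin> M" using cM[OF that(2), of z] that(3) by blast
      then show ?thesis using z nbD that by blast
    qed

    \<comment> \<open>Sufficient conditions for \<open>V\<close> to be spherical\<close>
    have HV: "H \<subseteq> V" using MV TM Vdec unfolding H_def by blast
    have finH: "finite H" using HV fin finite_subset by blast
    have hsH: "hereditarily_simplicial A X" if "X \<subseteq> V" for X
      using hs that by (rule hereditarily_simplicial_subset)

    \<comment> \<open>Deleting \<open>N[w]\<close> removes all of \<open>M\<close>. What is left of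
      \<open>D\<close> falls into classes of at least two twins by \<open>Dtwin\<close>, without
      edges to \<open>R\<close>. The last suspension is at the simplicial vertex
      \<open>d\<close>.\<close>
    have via_M: "spherical A V" if "w \<in> M" "d \<in> D" "A d w" "spherical A (R - closed_nbhd A w)" for w d
    proof -
      have "spherical A (V - closed_nbhd A w)"
      proof (rule spherical_attach_twins[of _ "R - closed_nbhd A w" "D - closed_nbhd A w"])
        show "\<exists>e'\<in>D - closed_nbhd A w. A e e'" if e: "e \<in> D - closed_nbhd A w" for e
        proof -
          obtain e' where e': "e' \<in> D" "A e e'"
            using e Dtwin[of e w] \<open>w \<in> M\<close> sym unfolding closed_nbhd_def by blast
          moreover have "e' \<notin> closed_nbhd A w"
            using e e' twin[of e' e w] \<open>w \<in> M\<close> MV DV sym unfolding closed_nbhd_def by blast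
          ultimately show ?thesis by blast
        qed
        show "\<not> A e x" if "e \<in> D - closed_nbhd A w" "x \<in> R - closed_nbhd A w" for e x
          using that nbD[of e x] DV Vdec by blast
        show "\<exists>d\<in>D - closed_nbhd A w. A d v"
          if "v \<in> V - closed_nbhd A w - (R - closed_nbhd A w) - (D - closed_nbhd A w)" for v
          using that Vdec cM \<open>w \<in> M\<close> unfolding closed_nbhd_def by blast
        show "D - closed_nbhd A w \<subseteq> V - closed_nbhd A w - (R - closed_nbhd A w)"
          using DV by auto
        show "v \<in> closed_nbhd A e'"
          if "e \<in> D - closed_nbhd A w" "e' \<in> D - closed_nbhd A w" "A e e'"
            "v \<in> V - closed_nbhd A w" "A e v" for e e' v
          using twin[of e e' v] that DV by blast
      qed (use fin Vdec that in auto)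
      then show ?thesis
        using spherical_suspend_simplicial[of V d w] that MV DV unfolding L_def by blast
    qed
    have via_R: "spherical A V" if "spherical A R"
    proof -
      obtain d where "d \<in> D" "A d p" using M0D pM by blast
      moreover have "R - closed_nbhd A p = R"
        using nbR pM sym pV unfolding closed_nbhd_def H_def by blast
      ultimately show ?thesis using via_M[of p d] pM that by simp
    qed
    have Hw: "H - closed_nbhd A w = R - closed_nbhd A w" if "w \<in> T" for w
      using cT that unfolding H_def clique_def closed_nbhd_def by auto
    have HT: "H - T = R" using DV TM unfolding H_def by auto
    have Hgp: "\<exists>z\<in>H. A x z \<and> \<not> A y z" if "x \<in> R" "y \<in> V" "y \<noteq> x" for x y
      using gp[of x y] nbR[OF that(1)] that Vdec by blast
    \<comment> \<open>Compare \<open>x\<close> with \<open>p\<close>: the witness lies in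
      \<open>H\<close> but not in \<open>T\<close>, since \<open>p\<close> is adjacent to all of
      \<open>T\<close>.\<close>
    have RR: "\<exists>z\<in>R. A x z" if x: "x \<in> R" for x
    proof -
      obtain z where "z \<in> H" "A x z" "\<not> A p z" using Hgp[of x p] x pV pM by blast
      then show ?thesis using cM pM TM unfolding H_def by blast
    qed
    \<comment> \<open>The induction hypothesis for \<open>H\<close> with two new vertices at
      \<open>S\<close>. \<open>RR\<close> and \<open>Hgp\<close> take care of \<open>R\<close>, so
      conditions remain only on \<open>T - S\<close>.\<close>
    have attach: "spherical A (H - S) \<or> (\<exists>w\<in>S. spherical A (H - closed_nbhd A w))"
      if S: "S \<subseteq> T" and abc: "a \<in> V - H" "b \<in> V - H" "c \<in> V - H" "a \<noteq> b" "a \<noteq> c" "b \<noteq> c"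
        and S1: "\<And>x. x \<in> T - S \<Longrightarrow> \<exists>z\<in>H - S. A x z"
        and S2: "\<And>x y. x \<in> T - S \<Longrightarrow> y \<in> H \<Longrightarrow> y \<noteq> x \<Longrightarrow> \<exists>z\<in>H. A x z \<and> \<not> A y z"
      for S a b c
    proof (rule spherical_attach_cases)
      show SH: "S \<subseteq> H" using S unfolding H_def by auto
      show cS: "clique A S" using cT S unfolding clique_def by blast
      show "spherical (attach A S {a, b}) (H \<union> {a, b})"
      proof (rule less.hyps)
        show "card (H \<union> {a, b}) < card V"
          using fin abc HV by (intro psubset_card_mono) auto
        show "sgraph (attach A S {a, b})" by (rule sgraph_attach)
        show "hereditarily_simplicial (attach A S {a, b}) (H \<union> {a, b})"
          using hereditarily_simplicial_attach hsH HV cS by blast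
        show "good_pair_free (attach A S {a, b}) (H \<union> {a, b})"
        proof (rule good_pair_free_attach)
          show "\<exists>z\<in>H - S. A x z" if "x \<in> H - S" for x
          proof (cases "x \<in> R")
            case True
            then show ?thesis using RR HT S by blast
          next
            case False
            then show ?thesis using S1 that unfolding H_def by blast
          qed
          show "\<exists>z\<in>H. A x z \<and> \<not> A y z" if "x \<in> H - S" "y \<in> H" "y \<noteq> x" for x y
            using Hgp[of x y] S2[of x y] that HV unfolding H_def by blast
        qed (use abc SH cS in auto)
      qed (use finH in auto)
    qed (use abc in auto)
    have DH: "D \<inter> H = {}" using DV TM unfolding H_def by blast
    have pH: "p \<in> V - H" using pM pV unfolding H_def by blast
    have allT: "spherical A V \<or> (\<exists>w\<in>T. spherical A (R - closed_nbhd A w))"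
      if abc: "a \<in> V - H" "b \<in> V - H" "c \<in> V - H" "a \<noteq> b" "a \<noteq> c" "b \<noteq> c" for a b c
      using attach[of T a b c] abc via_R Hw unfolding HT by auto

    \<comment> \<open>Case distinction: is some vertex of \<open>D\<close> adjacent to all of
      \<open>M\<close>?\<close>
    show ?thesis
    proof (cases "\<exists>u\<in>D. \<forall>m\<in>M. A u m")
      case True
      then obtain u where u: "u \<in> D" "\<And>m. m \<in> M \<Longrightarrow> A u m" by blast
      have uH: "u \<in> V - H" "u \<noteq> p" using u DH DV pM by auto
      \<comment> \<open>A third vertex outside \<open>H\<close>, besides \<open>p\<close> and
        \<open>u\<close>: two non-adjacent neighbours of \<open>p\<close> lie in
        \<open>M \<union> D\<close>, not both in \<open>M\<close>; if one is \<open>u\<close>, the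
        other lies in \<open>D\<close> too.\<close>
      have "\<not> simplicial A V p" using pV unfolding L_def by simp
      then obtain x y where xy: "x \<in> V" "y \<in> V" "A p x" "A p y" "x \<noteq> y" "\<not> A x y"
        using pV unfolding simplicial_def clique_def by blast
      have "x \<notin> R" "y \<notin> R" using xy nbR pH pV sym by blast+
      then have "\<exists>c\<in>V - H. c \<noteq> p \<and> c \<noteq> u"
        using xy u cM sym Vdec irr DH pH by (metis DiffI IntI UnE empty_iff)
      then obtain c where "c \<in> V - H" "c \<noteq> p" "c \<noteq> u" by blast
      then show ?thesis using allT[of p u c] pH uH u via_M TM by blast
    next
      case False
      then have Dt: "\<exists>d'\<in>D. A d d'" if "d \<in> D" for d using Dtwin that by blast
      obtain d where d: "d \<in> D" "A d p" using M0D pM by blast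
      obtain d' where d': "d' \<in> D" "A d d'" using Dt d by blast
      have abc: "d \<in> V - H" "d' \<in> V - H" "p \<in> V - H" "d \<noteq> d'" "d \<noteq> p" "d' \<noteq> p"
        using d d' irr pH DH DV pM by auto
      \<comment> \<open>\<open>via_M\<close> settles every \<open>w\<close> in \<open>T\<close>
        outside \<open>T0\<close>. For \<open>T0\<close>, the twins in \<open>D\<close> allow a
        reduction from \<open>V\<close> to \<open>R \<union> T0\<close>.\<close>
      define T0 where "T0 = {t \<in> T. \<forall>d\<in>D. \<not> A d t}"
      let ?X = "R \<union> T0"
      have T0T: "T0 \<subseteq> T" unfolding T0_def by auto
      have cT0: "A u v" if "u \<in> T0" "v \<in> T0" "u \<noteq> v" for u v
        using that cM T0T TM by blast
      have via_X: "spherical A V" if "spherical A ?X"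
      proof (rule spherical_attach_twins[of _ ?X D, OF _ _ _ that])
        show "\<not> A e x" if "e \<in> D" "x \<in> ?X" for e x
          using that nbD[of e x] DV Vdec unfolding T0_def by blast
        show "\<exists>d\<in>D. A d v" if "v \<in> V - ?X - D" for v
          using that Vdec M0D unfolding T0_def T_def by blast
        show "v \<in> closed_nbhd A e'" if "e \<in> D" "e' \<in> D" "A e e'" "v \<in> V" "A e v" for e e' v
          using twin[of e e' v] that DV by blast
        show "D \<subseteq> V - ?X" using DV TM T0T by auto
      qed (use fin Dt Vdec TM T0T in auto)
      have TR: "\<exists>z\<in>R. A x z" if "x \<in> T" for x
        using that Vdec DV unfolding T_def M0_def by blast
      from allT[OF abc] consider "spherical A V"
        | w where "w \<in> T0" "spherical A (R - closed_nbhd A w)"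
        using via_M TM unfolding T0_def by blast
      then show ?thesis
      proof cases
        case 1
        then show ?thesis .
      next
        case (2 w)
        show ?thesis
        proof (cases "\<forall>x\<in>T0. \<forall>y\<in>H. y \<noteq> x \<longrightarrow> (\<exists>z\<in>H. A x z \<and> \<not> A y z)")
          case True
          \<comment> \<open>With \<open>S = T - T0\<close>, each alternative is covered, by
            \<open>via_X\<close> or by \<open>via_M\<close>.\<close>
          have "spherical A (H - (T - T0)) \<or> (\<exists>w\<in>T - T0. spherical A (H - closed_nbhd A w))"
          proof (rule attach[OF _ abc])
            show "\<exists>z\<in>H - (T - T0). A x z" if "x \<in> T - (T - T0)" for x
              using TR[of x] that HT by blast
            show "\<exists>z\<in>H. A x z \<and> \<not> A y z" if "x \<in> T - (T - T0)" "y \<in> H" "y \<noteq> x" for x y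
              using True that T0T by blast
          qed auto
          moreover have "H - (T - T0) = ?X" using HT T0T unfolding H_def by blast
          ultimately show ?thesis using via_X via_M TM Hw unfolding T0_def by auto
        next
          case False
          then obtain x y where xy: "x \<in> T0" "y \<in> H" "y \<noteq> x" "\<And>z. z \<in> H \<Longrightarrow> A x z \<Longrightarrow> A y z"
            by blast
          have xH: "x \<in> H" using xy T0T unfolding H_def by blast
          \<comment> \<open>\<open>A x y\<close> fails, as it would give \<open>A y y\<close>; so
            the 4-cycle argument applies.\<close>
          have "simplicial A H x"
            using dominated_imp_simplicial[of H x y] hsH HV xH xy irr by blast
          then have xX: "simplicial A ?X x"
            using simplicial_subset[of A H x ?X] T0T xy unfolding H_def by blast
          \<comment> \<open>Suspend at \<open>x\<close>: every vertex of the clique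
            \<open>T0\<close> is \<open>x\<close> or a neighbour of \<open>x\<close>, hence lies in
            \<open>N[z]\<close>.\<close>
          have step: "spherical A V" if "z \<in> ?X" "A x z" "spherical A (R - closed_nbhd A z)" for z
          proof -
            have "T0 \<subseteq> closed_nbhd A z"
            proof
              fix t assume t: "t \<in> T0"
              show "t \<in> closed_nbhd A z"
              proof (cases "t = x")
                case True
                then show ?thesis using sym[OF that(2)] by (simp add: closed_nbhd_def)
              next
                case False
                then have "A x t" using cT0 t xy(1) by metis
                then show ?thesis using simplicialD[OF xX, of z t] that(1,2) t
                  unfolding closed_nbhd_def by blast
              qed
            qed
            then have "?X - closed_nbhd A z = R - closed_nbhd A z" by auto
            then show ?thesis
              using via_X spherical_suspend_simplicial[OF xX that(1,2)] that(3) by simp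
          qed
          show ?thesis
          proof (cases "w = x")
            case False
            then have "A x w" using cT0 2(1) xy(1) by metis
            then show ?thesis using step 2 by blast
          next
            case True
            \<comment> \<open>\<open>R - Z\<close> is \<open>R - N[x]\<close>, which is spherical
              because \<open>w = x\<close>. If \<open>step\<close> applies to no \<open>z\<close> in
              \<open>Z\<close>, then \<open>Z\<close> can be put back and \<open>R\<close> itself is
              spherical.\<close>
            define Z where "Z = {z \<in> R. A x z}"
            show ?thesis
            proof (cases "\<exists>z\<in>Z. spherical A (R - closed_nbhd A z)")
              case True
              then show ?thesis using step unfolding Z_def by blast
            next
              case False
              have "R - Z = R - closed_nbhd A x"
                using xy T0T TM DV unfolding Z_def closed_nbhd_def by auto
              then have "spherical A (R - Z)" using 2 True by simp
              moreover have "clique A Z"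
                using simplicialD[OF xX] unfolding Z_def clique_def by blast
              ultimately have "spherical A R"
                using spherical_insert_clique[of R Z] False hsH[of R] fin Vdec
                unfolding Z_def by (metis (no_types, lifting) finite_Un mem_Collect_eq subsetI sup_ge1 le_supI1)
              then show ?thesis by (rule via_R)
            qed
          qed
        qed
      qed
    qed
  qed
qed

subsection \<open>Chordal graphs\<close>

lemma shortest_relpowp_path:
  assumes "r\<^sup>*\<^sup>* a b"
  obtains f :: "nat \<Rightarrow> 'a" and n where "f 0 = a" "f n = b" "\<And>i. i < n \<Longrightarrow> r (f i) (f (Suc i))"
    "\<And>i j. i < j \<Longrightarrow> j \<le> n \<Longrightarrow> f i \<noteq> f j"
    "\<And>i j. Suc i < j \<Longrightarrow> j \<le> n \<Longrightarrow> \<not> r (f i) (f j)"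
proof -
  define n where "n = (LEAST n. (r ^^ n) a b)"
  have "\<exists>n. (r ^^ n) a b" using assms by (simp add: rtranclp_power)
  then have "(r ^^ n) a b" unfolding n_def by (rule LeastI_ex)
  then obtain f where f: "f 0 = a" "f n = b" "\<And>i. i < n \<Longrightarrow> r (f i) (f (Suc i))"
    unfolding relpowp_fun_conv by blast
  have short: "n \<le> m" if "(r ^^ m) a b" for m using that unfolding n_def by (rule Least_le)
  have pre: "(r ^^ i) a (f i)" if "i \<le> n" for i
    unfolding relpowp_fun_conv using f that by (intro exI[of _ f]) auto
  have post: "(r ^^ (n - j)) (f j) b" if "j \<le> n" for j
    unfolding relpowp_fun_conv using f that by (intro exI[of _ "\<lambda>k. f (j + k)"]) auto
  show thesis
  proof (rule that[OF f])
    show "f i \<noteq> f j" if "i < j" "j \<le> n" for i j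
    proof
      assume "f i = f j"
      then have "(r ^^ (i + (n - j))) a b"
        using pre[of i] post[of j] that unfolding relpowp_add by auto
      then show False using short that by fastforce
    qed
    show "\<not> r (f i) (f j)" if "Suc i < j" "j \<le> n" for i j
    proof
      assume "r (f i) (f j)"
      then have "(r ^^ (Suc i + (n - j))) a b"
        using pre[of i] post[of j] that relpowp_Suc_I[of i r a "f i" "f j"]
        unfolding relpowp_add by auto
      then show False using short that by fastforce
    qed
  qed auto
qed

text \<open>Otherwise a shortest path from \<open>a\<close> to \<open>b\<close> through
  \<open>C\<close>, closed up by \<open>v\<close>, is an induced cycle of length at least four: it
  has no chords, and its inner vertices avoid \<open>N[v]\<close>.\<close>

lemma chordal_common_neighbours:
  fixes V :: "'a set" and E :: "'a set set"
  defines "A \<equiv> \<lambda>u v. {u, v} \<in> E"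
  assumes irr: "\<And>u. \<not> A u u" and ch: "chordal V E" and CV: "insert v (C \<union> {a, b}) \<subseteq> V"
    and va: "A v a" "A v b" and ab: "a \<noteq> b"
    and Cv: "\<And>c. c \<in> C \<Longrightarrow> c \<noteq> v \<and> \<not> A v c"
    and c: "c1 \<in> C" "c2 \<in> C" "A a c1" "A c2 b"
    and conn: "(\<lambda>x y. x \<in> C \<and> y \<in> C \<and> A x y)\<^sup>*\<^sup>* c1 c2"
  shows "A a b"
proof (rule ccontr)
  assume nab: "\<not> A a b"
  have sym: "A x y \<longleftrightarrow> A y x" for x y unfolding A_def by (simp add: insert_commute)
  define S where "S = C \<union> {a, b}"
  define r where "r = (\<lambda>x y. x \<in> S \<and> y \<in> S \<and> A x y)"
  have "r\<^sup>*\<^sup>* c1 c2" by (rule rtranclp_mono[THEN predicate2D, OF _ conn]) (auto simp: r_def S_def)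
  moreover have "r a c1" "r c2 b" using c unfolding r_def S_def by auto
  ultimately have "r\<^sup>*\<^sup>* a b"
    by (meson converse_rtranclp_into_rtranclp rtranclp.rtrancl_into_rtrancl)
  then obtain f n where f: "f 0 = a" "f n = b" "\<And>i. i < n \<Longrightarrow> r (f i) (f (Suc i))"
    "\<And>i j. i < j \<Longrightarrow> j \<le> n \<Longrightarrow> f i \<noteq> f j"
    "\<And>i j. Suc i < j \<Longrightarrow> j \<le> n \<Longrightarrow> \<not> r (f i) (f j)"
    by (rule shortest_relpowp_path) blast
  have n2: "2 \<le> n"
  proof (rule ccontr)
    assume "\<not> 2 \<le> n"
    then have "n = 0 \<or> n = 1" by auto
    then show False using f(3)[of 0] f(1,2) ab nab unfolding r_def by auto
  qed
  have fS: "f i \<in> S" if "i \<le> n" for i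
    using that f(2) f(3)[of i] unfolding r_def S_def by (cases "i = n") auto
  have fA: "A (f i) (f j) \<longleftrightarrow> j = Suc i \<or> i = Suc j" if "i \<le> n" "j \<le> n" for i j
  proof -
    consider "i = j" | "j = Suc i" | "i = Suc j" | "Suc i < j" | "Suc j < i" by linarith
    then show ?thesis
    proof cases
      case 1
      then show ?thesis using irr by auto
    next
      case 2
      then show ?thesis using f(3)[of i] that unfolding r_def by auto
    next
      case 3
      then show ?thesis using f(3)[of j] that sym[of "f i"] unfolding r_def by auto
    next
      case 4
      then show ?thesis using f(5)[of i j] that fS unfolding r_def by auto
    next
      case 5
      then show ?thesis using f(5)[of j i] that fS sym[of "f i"] unfolding r_def by auto
    qed
  qed
  have fv: "f i \<noteq> v" "A v (f i) \<longleftrightarrow> i = 0 \<or> i = n" if "i \<le> n" for i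
  proof -
    have vS: "v \<notin> S" using Cv va irr unfolding S_def by blast
    then show "f i \<noteq> v" using fS[OF that] by auto
    show "A v (f i) \<longleftrightarrow> i = 0 \<or> i = n"
    proof (cases "i = 0 \<or> i = n")
      case True
      then show ?thesis using va f by auto
    next
      case False
      then have "f i \<noteq> a" "f i \<noteq> b" using f(4)[of 0 i] f(4)[of i n] f(1,2) that by auto
      then have "f i \<in> C" using fS[OF that] unfolding S_def by auto
      then show ?thesis using Cv False by auto
    qed
  qed
  \<comment> \<open>\<open>v\<close> takes position 0, which shifts \<open>f i\<close> to position
    \<open>Suc i\<close>; the length is \<open>n + 2\<close>.\<close>
  define c where "c = v # map f [0..<Suc n]"
  have lc: "length c = n + 2" unfolding c_def by simp
  have c0: "c ! 0 = v" unfolding c_def by simp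
  have cS: "c ! Suc i = f i" if "i \<le> n" for i
    unfolding c_def using that by (simp del: upt_Suc)
  have "induced_cycle V E c"
    unfolding induced_cycle_def lc
  proof (intro conjI allI impI)
    have "inj_on f {0..<Suc n}"
      by (rule linorder_inj_onI) (use f(4) in \<open>auto simp: less_Suc_eq_le\<close>)
    then show "distinct c"
      using fv(1) unfolding c_def by (force simp del: upt_Suc simp: distinct_map less_Suc_eq_le)
    show "set c \<subseteq> V"
      using CV fS unfolding c_def S_def by (fastforce simp del: upt_Suc simp: less_Suc_eq_le)
    fix i j assume ij: "i < n + 2" "j < n + 2"
    have m: "Suc k mod (n + 2) = (if k = n + 1 then 0 else Suc k)" if "k < n + 2" for k
      using that by auto
    have "A (c ! i) (c ! j) \<longleftrightarrow> j = Suc i mod (n + 2) \<or> i = Suc j mod (n + 2)"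
    proof (cases i; cases j)
      assume "i = 0" "j = 0"
      then show ?thesis using irr n2 c0 by simp
    next
      fix j' assume *: "i = 0" "j = Suc j'"
      then show ?thesis using fv(2)[of j'] cS[of j'] c0 ij n2 m by (auto split: if_splits)
    next
      fix i' assume *: "i = Suc i'" "j = 0"
      then show ?thesis using fv(2)[of i'] cS[of i'] c0 ij n2 m sym[of "f i'"]
        by (auto split: if_splits)
    next
      fix i' j' assume *: "i = Suc i'" "j = Suc j'"
      then show ?thesis using fA[of i' j'] cS[of i'] cS[of j'] ij m by (auto split: if_splits)
    qed
    then show "({c ! i, c ! j} \<in> E) = (j = Suc i mod (n + 2) \<or> i = Suc j mod (n + 2))"
      unfolding A_def .
  qed (use n2 in auto)
  then show False using ch lc n2 unfolding chordal_def by force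
qed

text \<open>Dirac's theorem. Avoiding a clique \<open>T\<close> makes the induction work, since
  boundaries of components are cliques.\<close>

lemma chordal_imp_simplicial:
  fixes V :: "'a set" and E :: "'a set set"
  defines "A \<equiv> \<lambda>u v. {u, v} \<in> E"
  assumes G: "sgraph A" and fin: "finite V" and ch: "chordal V E"
    and "W \<subseteq> V" "T \<subseteq> W" "clique A T" "T \<noteq> W"
  shows "\<exists>s\<in>W - T. simplicial A W s"
  using assms(5-)
proof (induction "card W" arbitrary: W T rule: less_induct)
  case less
  interpret sgraph A by (rule G)
  have finW: "finite W" using fin less.prems finite_subset by blast
  \<comment> \<open>\<open>C\<close> is a component of \<open>W - N[v]\<close> and \<open>S\<close>
    its boundary, a clique contained in \<open>N(v)\<close>. A simplicial vertex of
    \<open>C \<union> S\<close> outside \<open>S\<close> has no neighbours in \<open>W\<close>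
    beyond \<open>C \<union> S\<close>.\<close>
  have away: "\<exists>s\<in>W - closed_nbhd A v. simplicial A W s"
    if v: "v \<in> W" "W - closed_nbhd A v \<noteq> {}" for v
  proof -
    define U where "U = W - closed_nbhd A v"
    define r where "r = (\<lambda>x y. x \<in> U \<and> y \<in> U \<and> A x y)"
    obtain c0 where c0: "c0 \<in> U" using v unfolding U_def by auto
    define C where "C = {c. r\<^sup>*\<^sup>* c0 c}"
    have CU: "C \<subseteq> U"
    proof
      fix c assume "c \<in> C"
      then have "r\<^sup>*\<^sup>* c0 c" unfolding C_def by simp
      then show "c \<in> U" by cases (use c0 in \<open>auto simp: r_def\<close>)
    qed
    have c0C: "c0 \<in> C" unfolding C_def by simp
    have Cr: "c' \<in> C" if "c \<in> C" "c' \<in> U" "A c c'" for c c'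
      using that CU unfolding C_def r_def by (auto intro: rtranclp.rtrancl_into_rtrancl)
    have symr: "symp r" unfolding r_def symp_def using sym by blast
    have conn: "r\<^sup>*\<^sup>* c c'" if "c \<in> C" "c' \<in> C" for c c'
      using that symp_rtranclp[OF symr] unfolding C_def
      by (metis mem_Collect_eq rtranclp_trans sympD)
    define S where "S = {s \<in> W - C. \<exists>c\<in>C. A c s}"
    have Sv: "A v s" if s: "s \<in> S" for s
    proof -
      obtain c where "c \<in> C" "A c s" "s \<in> W" "s \<notin> C" using s unfolding S_def by blast
      then have "s \<in> closed_nbhd A v" using Cr[of c s] unfolding U_def by blast
      moreover have "s \<noteq> v" using \<open>c \<in> C\<close> \<open>A c s\<close> CU sym unfolding U_def closed_nbhd_def by blast
      ultimately show ?thesis unfolding closed_nbhd_def by blast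
    qed
    have cS: "clique A S"
      unfolding clique_def
    proof (intro ballI impI)
      fix a b assume ab: "a \<in> S" "b \<in> S" "a \<noteq> b"
      then obtain c1 c2 where c: "c1 \<in> C" "c2 \<in> C" "A c1 a" "A c2 b" unfolding S_def by blast
      show "A a b"
        unfolding A_def
      proof (rule chordal_common_neighbours[where C = U and v = v and V = V and ?c1.0 = c1 and ?c2.0 = c2])
        show "insert v (U \<union> {a, b}) \<subseteq> V"
          using ab v less.prems unfolding U_def S_def by auto
        show "(\<lambda>x y. x \<in> U \<and> y \<in> U \<and> {x, y} \<in> E)\<^sup>*\<^sup>* c1 c2"
          using conn[OF c(1,2)] unfolding r_def A_def .
      qed (use ab c CU sym irr ch Sv in \<open>auto simp: A_def U_def closed_nbhd_def\<close>)
    qed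
    have "C \<union> S \<subseteq> W - {v}"
      using CU Sv irr unfolding U_def S_def closed_nbhd_def by auto
    then have CS: "C \<union> S \<subseteq> W" "card (C \<union> S) < card W"
      using v finW by (auto intro!: psubset_card_mono)
    have "S \<noteq> C \<union> S" using c0C unfolding S_def by auto
    then obtain s where s: "s \<in> C \<union> S - S" "simplicial A (C \<union> S) s"
      using less.hyps[OF CS(2), of S] CS(1) cS less.prems(1) by blast
    have "{u \<in> W. A s u} = {u \<in> C \<union> S. A s u}"
      using s CS(1) unfolding S_def by auto
    then have "simplicial A W s" using s CS(1) unfolding simplicial_def by auto
    moreover have "s \<in> U" using s CU by auto
    ultimately show ?thesis unfolding U_def by blast
  qed
  \<comment> \<open>Vertices of \<open>K\<close> are adjacent to all others, so putting them back
    keeps \<open>s\<close> simplicial.\<close>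
  have dominating: "\<exists>s\<in>W - K. simplicial A W s"
    if K: "K \<subseteq> W" "K \<noteq> {}" "K \<noteq> W" "clique A K" "\<And>v u. v \<in> K \<Longrightarrow> u \<in> W \<Longrightarrow> u \<in> closed_nbhd A v" for K
  proof -
    have "card (W - K) < card W" using finW K by (intro psubset_card_mono) auto
    then obtain s where s: "s \<in> W - K" "simplicial A (W - K) s"
      using less.hyps[of "W - K" "{}"] K(1,3) less.prems(1) by (auto simp: clique_def)
    have "A x y" if "x \<in> W" "y \<in> W" "A s x" "A s y" "x \<noteq> y" for x y
      using that K(5)[of x y] K(5)[of y x] simplicialD[OF s(2), of x y] sym
      unfolding closed_nbhd_def by blast
    then have "simplicial A W s" using s unfolding simplicial_def clique_def by blast
    then show ?thesis using s by blast
  qed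
  show ?case
  proof (cases "\<exists>v\<in>T. W - closed_nbhd A v \<noteq> {}")
    case True
    then obtain v where v: "v \<in> T" "W - closed_nbhd A v \<noteq> {}" by blast
    then have "T \<subseteq> closed_nbhd A v"
      using less.prems unfolding clique_def closed_nbhd_def by auto
    then show ?thesis using away[of v] v less.prems by blast
  next
    case F: False
    show ?thesis
    proof (cases "T = {}")
      case False
      then show ?thesis using dominating[of T] F less.prems by blast
    next
      case True
      then obtain v where v: "v \<in> W" using less.prems by auto
      have "\<exists>s. simplicial A W s"
      proof (cases "W - closed_nbhd A v = {}")
        case True
        show ?thesis
        proof (cases "W = {v}")
          case W: True
          then show ?thesis using irr by (intro exI[of _ v]) (auto simp: simplicial_def clique_def)
        next
          case False
          then show ?thesis using dominating[of "{v}"] True v by (auto simp: clique_def)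
        qed
      next
        case False
        then show ?thesis using away v by blast
      qed
      then show ?thesis using True simplicial_mem[of A W] by blast
    qed
  qed
qed

lemma chordal_imp_hereditarily_simplicial:
  assumes "sgraph (\<lambda>u v. {u, v} \<in> E)" "finite V" "chordal V E"
  shows "hereditarily_simplicial (\<lambda>u v. {u, v} \<in> E) V"
  unfolding hereditarily_simplicial_def
proof (intro allI impI)
  fix W assume "W \<subseteq> V" "W \<noteq> {}"
  then show "\<exists>s. simplicial (\<lambda>u v. {u, v} \<in> E) W s"
    using chordal_imp_simplicial[OF assms, of W "{}"] by (auto simp: clique_def)
qed

subsection \<open>Retraction onto a sphere\<close>

text \<open>The cross-polytope has vertices \<open>e i \<beta>\<close> for \<open>i < k\<close>, with \<open>e i True\<close> opposite to \<open>e i False\<close>,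
  and the retraction sends \<open>v\<close> to \<open>e (c v) (b v)\<close>.\<close>

definition cross_polytope_retraction ::
  "('a \<Rightarrow> 'a \<Rightarrow> bool) \<Rightarrow> 'a set \<Rightarrow> nat \<Rightarrow> ('a \<Rightarrow> nat) \<Rightarrow> ('a \<Rightarrow> bool) \<Rightarrow> (nat \<Rightarrow> bool \<Rightarrow> 'a) \<Rightarrow> bool"
  where "cross_polytope_retraction A V k c b e \<longleftrightarrow>
    (\<forall>v\<in>V. c v < k) \<and>
    (\<forall>i<k. \<forall>\<beta>. e i \<beta> \<in> V \<and> c (e i \<beta>) = i \<and> b (e i \<beta>) = \<beta>) \<and>
    (\<forall>i<k. \<forall>j<k. \<forall>\<beta> \<gamma>. i \<noteq> j \<longrightarrow> \<not> A (e i \<beta>) (e j \<gamma>)) \<and>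
    (\<forall>u\<in>V. \<forall>v\<in>V. \<not> A u v \<longrightarrow> c u = c v \<longrightarrow> u \<noteq> v \<longrightarrow> b u = b v)"

lemma spherical_imp_cross_polytope_retraction:
  assumes "sgraph A" "spherical A V"
  shows "\<exists>k c b e. cross_polytope_retraction A V k c b e"
  using assms(2)
proof (induction rule: spherical.induct)
  case empty
  show ?case by (rule exI[of _ 0]) (simp add: cross_polytope_retraction_def)
next
  case (suspend s V w)
  interpret sgraph A by (rule assms)
  obtain k c b e where cpr: "cross_polytope_retraction A (V - closed_nbhd A w) k c b e"
    using suspend.IH by blast
  have h1: "c v < k" if "v \<in> V - closed_nbhd A w" for v
    using cpr that unfolding cross_polytope_retraction_def by simp
  have h2: "e i \<beta> \<in> V - closed_nbhd A w \<and> c (e i \<beta>) = i \<and> b (e i \<beta>) = \<beta>" if "i < k" for i \<beta>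
    using cpr that unfolding cross_polytope_retraction_def by simp
  have h3: "\<not> A (e i \<beta>) (e j \<gamma>)" if "i < k" "j < k" "i \<noteq> j" for i j \<beta> \<gamma>
    using cpr that unfolding cross_polytope_retraction_def by simp
  have h4: "b u = b v" if "u \<in> V - closed_nbhd A w" "v \<in> V - closed_nbhd A w" "\<not> A u v"
    "c u = c v" "u \<noteq> v" for u v
    using cpr that unfolding cross_polytope_retraction_def by simp
  \<comment> \<open>The new coordinate \<open>k\<close> carries \<open>N[w]\<close>, where only
    \<open>w\<close> has sign \<open>True\<close>. A face containing \<open>w\<close> has no other
    vertex in \<open>N[w]\<close>, so no face gets both signs; \<open>N[s] \<subseteq> N[w]\<close>
    keeps \<open>s\<close> non-adjacent to the old \<open>e i \<beta>\<close>.\<close>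
  define c' where "c' v = (if v \<in> closed_nbhd A w then k else c v)" for v
  define b' where "b' v = (if v \<in> closed_nbhd A w then v = w else b v)" for v
  define e' where "e' i \<beta> = (if i = k then if \<beta> then w else s else e i \<beta>)" for i \<beta>
  have sw: "s \<in> closed_nbhd A w" "w \<in> closed_nbhd A w" "s \<noteq> w"
    using suspend.hyps(3) sym irr unfolding closed_nbhd_def by blast+
  have ns: "\<not> A w (e i \<beta>)" "\<not> A s (e i \<beta>)" "\<not> A (e i \<beta>) w" "\<not> A (e i \<beta>) s" if "i < k" for i \<beta>
    using h2[OF that, of \<beta>] suspend.hyps(4)[of "e i \<beta>"] sym unfolding closed_nbhd_def by blast+
  have "cross_polytope_retraction A V (Suc k) c' b' e'"
    unfolding cross_polytope_retraction_def
  proof (intro conjI ballI allI impI)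
    fix v assume "v \<in> V"
    then show "c' v < Suc k" using h1[of v] unfolding c'_def by auto
  next
    fix i \<beta> assume i: "i < Suc k"
    show "e' i \<beta> \<in> V" "c' (e' i \<beta>) = i" "b' (e' i \<beta>) = \<beta>"
      using h2[of i \<beta>] i sw suspend.hyps(1,2) unfolding e'_def c'_def b'_def
      by (cases "i = k"; auto)+
  next
    fix i j \<beta> \<gamma> assume "i < Suc k" "j < Suc k" "i \<noteq> j"
    then show "\<not> A (e' i \<beta>) (e' j \<gamma>)"
      using h3[of i j \<beta> \<gamma>] ns unfolding e'_def by auto
  next
    fix u v assume uv: "u \<in> V" "v \<in> V" "\<not> A u v" "c' u = c' v" "u \<noteq> v"
    show "b' u = b' v"
    proof (cases "u \<in> closed_nbhd A w \<longleftrightarrow> v \<in> closed_nbhd A w")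
      case True
      then show ?thesis
        using uv h4[of u v] sym unfolding b'_def c'_def by (auto simp: closed_nbhd_def)
    next
      case False
      then show ?thesis using uv h1[of u] h1[of v] unfolding c'_def by auto
    qed
  qed
  then show ?case by blast
qed

text \<open>Since \<open>F\<close> after \<open>g\<close> is the identity, the sphere is homotopy
  dominated by the realization and would inherit contractibility. The \<open>n + 1\<close>
  coordinates give a sphere of dimension \<open>n\<close>.\<close>

lemma cross_polytope_retraction_not_contractible:
  fixes V :: "'a set" and E :: "'a set set"
  assumes fin: "finite V" and irr: "\<And>u. {u} \<notin> E"
    and cpr: "cross_polytope_retraction (\<lambda>u v. {u, v} \<in> E) V (Suc n) c b e"
  shows "\<not> contractible_space (geometric_realization (Ind V E))"
proof
  let ?X = "geometric_realization (Ind V E)"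
  assume X: "contractible_space ?X"
  have c: "c v \<le> n" if "v \<in> V" for v
    using cpr that unfolding cross_polytope_retraction_def by (simp add: less_Suc_eq_le)
  have e: "e i \<beta> \<in> V \<and> c (e i \<beta>) = i \<and> b (e i \<beta>) = \<beta>" if "i \<le> n" for i \<beta>
    using cpr that unfolding cross_polytope_retraction_def by (simp add: less_Suc_eq_le)
  have ee: "{e i \<beta>, e j \<gamma>} \<notin> E" if "i \<le> n" "j \<le> n" "i \<noteq> j" for i j \<beta> \<gamma>
    using cpr that unfolding cross_polytope_retraction_def by (simp add: less_Suc_eq_le)
  have cb: "b u = b v" if "u \<in> V" "v \<in> V" "{u, v} \<notin> E" "c u = c v" "u \<noteq> v" for u v
    using cpr that unfolding cross_polytope_retraction_def by simp
  define sg :: "bool \<Rightarrow> real" where "sg \<beta> = (if \<beta> then 1 else -1)" for \<beta>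
  \<comment> \<open>\<open>f\<close> extends the retraction linearly, with
    \<open>e i \<beta>\<close> at plus or minus the unit vector \<open>i\<close>, and
    \<open>F\<close> normalizes to the unit sphere. Conversely \<open>g\<close> divides by the l1
    norm \<open>N\<close> and gives the positive and negative parts of \<open>u i\<close> to
    \<open>e i True\<close> and \<open>e i False\<close>.\<close>
  define f :: "('a \<Rightarrow> real) \<Rightarrow> nat \<Rightarrow> real"
    where "f t i = (\<Sum>v | v \<in> V \<and> c v = i. sg (b v) * t v)" for t i
  define F where "F t i = f t i / sqrt (\<Sum>j\<le>n. (f t j)\<^sup>2)" for t i
  define N :: "(nat \<Rightarrow> real) \<Rightarrow> real" where "N u = (\<Sum>j\<le>n. \<bar>u j\<bar>)" for u
  define g :: "(nat \<Rightarrow> real) \<Rightarrow> 'a \<Rightarrow> real"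
    where "g u v = (if v \<in> V \<and> v = e (c v) (b v) then max 0 (sg (b v) * u (c v)) / N u else 0)" for u v
  have topX: "topspace ?X = {t. (\<forall>v. 0 \<le> t v) \<and> {v. t v \<noteq> 0} \<in> Ind V E \<and> (\<Sum>v | t v \<noteq> 0. t v) = 1}"
    unfolding geometric_realization_def by simp
  have topS: "topspace (nsphere n) = {x. (\<Sum>i\<le>n. (x i)\<^sup>2) = 1 \<and> (\<forall>i>n. x i = 0)}"
    unfolding nsphere by simp
  have f0: "f t i = 0" if "i > n" for t i
  proof -
    have "{v. v \<in> V \<and> c v = i} = {}" using c that by fastforce
    then show ?thesis unfolding f_def by (simp only: sum.empty)
  qed
  \<comment> \<open>Vertices of the support with the same coordinate are non-adjacent, so they have
    the same sign and nothing cancels.\<close>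
  have fnz: "\<exists>i\<le>n. f t i \<noteq> 0" if t: "t \<in> topspace ?X" for t
  proof -
    have tp: "\<And>v. 0 \<le> t v" and ti: "{v. t v \<noteq> 0} \<in> Ind V E" and ts: "(\<Sum>v | t v \<noteq> 0. t v) = 1"
      using t unfolding topX by auto
    obtain v where v: "t v \<noteq> 0" using ts by (metis (mono_tags, lifting) empty_Collect_eq sum.empty zero_neq_one)
    have vV: "v \<in> V" using ti v unfolding Ind_def by auto
    have "sg (b u) * t u = sg (b v) * t u" if "u \<in> V" "c u = c v" for u
    proof (cases "t u = 0 \<or> u = v")
      case False
      then have "{u, v} \<notin> E" using ti v unfolding Ind_def by auto
      then have "b u = b v" using cb[of u v] that vV False by auto
      then show ?thesis by simp
    qed auto
    then have "f t (c v) = sg (b v) * (\<Sum>u | u \<in> V \<and> c u = c v. t u)"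
      unfolding f_def sum_distrib_left by (intro sum.cong) auto
    moreover have "(\<Sum>u | u \<in> V \<and> c u = c v. t u) > 0"
      using fin tp v vV by (intro sum_pos2[of _ v]) (auto simp: order_less_le)
    ultimately have "f t (c v) \<noteq> 0" unfolding sg_def by auto
    then show ?thesis using c vV by blast
  qed
  have fpos: "(\<Sum>j\<le>n. (f t j)\<^sup>2) > 0" if "t \<in> topspace ?X" for t
    using fnz[OF that] by (auto intro!: sum_pos2)
  have contF: "continuous_map ?X (nsphere n) F"
    unfolding nsphere continuous_map_in_subtopology continuous_map_componentwise_UNIV
  proof (intro conjI allI)
    have proj: "continuous_map ?X euclideanreal (\<lambda>t. t v)" for v
      unfolding geometric_realization_def
      by (intro continuous_map_from_subtopology continuous_map_product_projection) auto
    have cf: "continuous_map ?X euclideanreal (\<lambda>t. f t i)" for i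
      unfolding f_def using fin by (intro continuous_intros proj) auto
    have "continuous_map ?X euclideanreal (sqrt \<circ> (\<lambda>t. \<Sum>j\<le>n. (f t j)\<^sup>2))"
      by (intro continuous_map_compose[OF _ continuous_map_square_root] continuous_intros cf) auto
    then show "continuous_map ?X euclideanreal (\<lambda>t. F t i)" for i
      unfolding F_def o_def using fpos cf
      by (intro continuous_intros) fastforce+
    show "F \<in> topspace ?X \<rightarrow> {x. (\<Sum>i\<le>n. (x i)\<^sup>2) = 1 \<and> (\<forall>i>n. x i = 0)}"
    proof (intro Pi_I CollectI conjI allI impI)
      fix t assume t: "t \<in> topspace ?X"
      have "(\<Sum>i\<le>n. (F t i)\<^sup>2) = (\<Sum>i\<le>n. (f t i)\<^sup>2 / (\<Sum>j\<le>n. (f t j)\<^sup>2))"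
        using fpos[OF t] unfolding F_def by (simp add: power_divide)
      also have "\<dots> = 1" using fpos[OF t] by (simp flip: sum_divide_distrib)
      finally show "(\<Sum>i\<le>n. (F t i)\<^sup>2) = 1" .
    qed (simp add: F_def f0)
  qed
  have Npos: "N u > 0" if "u \<in> topspace (nsphere n)" for u
  proof -
    have "\<exists>i\<le>n. u i \<noteq> 0"
    proof (rule ccontr)
      assume "\<not> ?thesis"
      then have "(\<Sum>i\<le>n. (u i)\<^sup>2) = 0" by simp
      then show False using that unfolding topS by simp
    qed
    then show ?thesis unfolding N_def by (auto intro!: sum_pos2)
  qed
  have ge: "g u (e i \<beta>) = max 0 (sg \<beta> * u i) / N u" if "i \<le> n" for u i \<beta>
    using e[OF that, of \<beta>] unfolding g_def by auto
  have gne: "\<exists>i\<le>n. \<exists>\<beta>. v = e i \<beta>" if "g u v \<noteq> 0" for u v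
    using that c[of v] unfolding g_def by (auto split: if_splits)
  have einj: "e i \<beta> = e j \<gamma> \<longleftrightarrow> i = j \<and> \<beta> = \<gamma>" if "i \<le> n" "j \<le> n" for i j \<beta> \<gamma>
  proof
    assume "e i \<beta> = e j \<gamma>"
    then have "c (e i \<beta>) = c (e j \<gamma>)" "b (e i \<beta>) = b (e j \<gamma>)" by simp_all
    then show "i = j \<and> \<beta> = \<gamma>" using e that by simp
  qed simp
  have contg: "continuous_map (nsphere n) ?X g"
    unfolding geometric_realization_def continuous_map_in_subtopology continuous_map_componentwise_UNIV
  proof (intro conjI allI)
    fix v
    note proj = continuous_map_nsphere_projection[of n]
    have "continuous_map (nsphere n) euclideanreal (\<lambda>u. max 0 (sg (b v) * u (c v)) / N u)"
      unfolding N_def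
      by (intro continuous_intros proj) (use Npos in \<open>fastforce simp: N_def\<close>)+
    then show "continuous_map (nsphere n) euclideanreal (\<lambda>u. g u v)"
      unfolding g_def by (cases "v \<in> V \<and> v = e (c v) (b v)") auto
  next
    show "g \<in> topspace (nsphere n) \<rightarrow>
      {t. (\<forall>v. 0 \<le> t v) \<and> {v. t v \<noteq> 0} \<in> Ind V E \<and> (\<Sum>v | t v \<noteq> 0. t v) = 1}"
    proof (intro Pi_I CollectI conjI allI)
      fix u assume u: "u \<in> topspace (nsphere n)"
      note Nu = Npos[OF u]
      show "0 \<le> g u v" for v using Nu unfolding g_def by auto
      show "{v. g u v \<noteq> 0} \<in> Ind V E"
        unfolding Ind_def
      proof (intro CollectI conjI ballI subsetI)
        show "v \<in> V" if "v \<in> {v. g u v \<noteq> 0}" for v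
          using that unfolding g_def by (auto split: if_splits)
        fix x y assume xy: "x \<in> {v. g u v \<noteq> 0}" "y \<in> {v. g u v \<noteq> 0}"
        obtain i \<beta> where i: "i \<le> n" "x = e i \<beta>" using xy(1) gne[of u x] by blast
        obtain j \<gamma> where j: "j \<le> n" "y = e j \<gamma>" using xy(2) gne[of u y] by blast
        show "{x, y} \<notin> E"
        proof (cases "i = j")
          case True
          \<comment> \<open>\<open>u i\<close> cannot have both signs, so opposite vertices are
            never both in the support.\<close>
          have "sg \<beta> * u i > 0" "sg \<gamma> * u i > 0"
            using xy ge[OF i(1), of u \<beta>] ge[OF i(1), of u \<gamma>]
            unfolding i j True by (auto simp: max_def less_le split: if_splits)
          then have "\<beta> = \<gamma>" unfolding sg_def by (auto split: if_splits)
          then show ?thesis using i j True irr by simp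
        next
          case False
          then show ?thesis using ee i j by simp
        qed
      qed
      have "(\<Sum>v | g u v \<noteq> 0. g u v) = (\<Sum>v\<in>case_prod e ` ({..n} \<times> UNIV). g u v)"
      proof (rule sum.mono_neutral_left)
        show "{v. g u v \<noteq> 0} \<subseteq> case_prod e ` ({..n} \<times> UNIV)"
          using gne by fastforce
      qed auto
      also have "\<dots> = (\<Sum>(i, \<beta>)\<in>{..n} \<times> UNIV. g u (e i \<beta>))"
        by (subst sum.reindex) (auto simp: inj_on_def einj o_def case_prod_unfold)
      also have "\<dots> = (\<Sum>i\<le>n. \<bar>u i\<bar> / N u)"
        unfolding sum.cartesian_product[symmetric]
        by (rule sum.cong) (auto simp: UNIV_bool ge sg_def max_def)
      also have "\<dots> = 1" using Nu unfolding N_def by (simp flip: sum_divide_distrib)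
      finally show "(\<Sum>v | g u v \<noteq> 0. g u v) = 1" .
    qed
  qed
  have Fg: "F (g u) = u" if u: "u \<in> topspace (nsphere n)" for u
  proof
    fix i
    note Nu = Npos[OF u]
    have fg: "f (g u) j = u j / N u" if j: "j \<le> n" for j
    proof -
      have "f (g u) j = (\<Sum>v\<in>{e j True, e j False}. sg (b v) * g u v)"
        unfolding f_def
      proof (rule sum.mono_neutral_right)
        show "\<forall>v\<in>{v. v \<in> V \<and> c v = j} - {e j True, e j False}. sg (b v) * g u v = 0"
          unfolding g_def by (auto split: if_splits) (metis (full_types))
      qed (use fin e[OF j] in auto)
      also have "\<dots> = u j / N u"
        using ge[OF j] e[OF j] einj[OF j j] by (auto simp: sg_def max_def)
      finally show ?thesis .
    qed
    have "(\<Sum>j\<le>n. (f (g u) j)\<^sup>2) = (\<Sum>j\<le>n. (u j)\<^sup>2 / (N u)\<^sup>2)"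
      by (rule sum.cong) (auto simp: fg power_divide)
    also have "\<dots> = 1 / (N u)\<^sup>2"
      using u unfolding topS by (simp flip: sum_divide_distrib)
    finally have "sqrt (\<Sum>j\<le>n. (f (g u) j)\<^sup>2) = 1 / N u"
      using Nu by (simp add: real_sqrt_divide)
    then show "F (g u) i = u i"
      using Nu fg[of i] f0[of i "g u"] u unfolding F_def topS by (cases "i \<le> n") auto
  qed
  have "homotopic_with (\<lambda>x. True) (nsphere n) (nsphere n) (F \<circ> g) id"
    by (rule homotopic_with_equal) (auto simp: Fg intro: continuous_map_compose[OF contg contF])
  then have "contractible_space (nsphere n)"
    using homotopy_dominated_contractibility[OF contF contg] X by blast
  then show False using non_contractible_space_nsphere by blast
qed

section \<open>Conclusion for chordal graphs with contractible independence complex\<close>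

theorem theorem2p3:
  fixes V :: "'a set" and E :: "'a set set"
  assumes "finite_simple_graph V E"
    and "chordal V E"
    and "contractible_complex (Ind V E)"
  shows "card V = 1 \<or> (\<exists>x y. good_pair V E x y)"
proof (rule ccontr)
  assume neg: "\<not> ?thesis"
  define A where "A = (\<lambda>u v. {u, v} \<in> E)"
  have fin: "finite V" and EV: "\<And>u v. A u v \<Longrightarrow> u \<in> V \<and> v \<in> V" and irr: "\<And>u. {u} \<notin> E"
    using assms(1) unfolding finite_simple_graph_def A_def by force+
  have G: "sgraph A"
    by standard (auto simp: A_def insert_commute irr)
  \<comment> \<open>Without vertices the coordinates of a point would sum to 0 instead of 1.\<close>
  have "V \<noteq> {}"
  proof
    assume "V = {}"
    then have "topspace (geometric_realization (Ind V E)) = {}"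
      unfolding geometric_realization_def Ind_def by auto
    then show False using assms(3) unfolding contractible_complex_def by simp
  qed
  have gp: "\<exists>z\<in>V. A x z \<and> \<not> A y z" if "x \<in> V" "y \<in> V" "y \<noteq> x" for x y
    using neg that EV unfolding good_pair_def open_nbhd_def A_def by blast
  have "\<exists>y\<in>V. A x y" if x: "x \<in> V" for x
  proof -
    have "V \<noteq> {x}" using neg by auto
    then obtain y where "y \<in> V" "y \<noteq> x" using x by blast
    then show ?thesis using gp x by blast
  qed
  then have "good_pair_free A V" using gp unfolding good_pair_free_def by blast
  moreover have "hereditarily_simplicial A V"
    using chordal_imp_hereditarily_simplicial[of E V] G fin assms(2) unfolding A_def by blast
  ultimately have "spherical A V" using good_pair_free_imp_spherical G fin by blast
  then obtain k c b e where cpr: "cross_polytope_retraction A V k c b e"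
    using spherical_imp_cross_polytope_retraction[OF G] by blast
  \<comment> \<open>Every vertex needs a coordinate below \<open>k\<close>, and \<open>V\<close> is
    nonempty.\<close>
  moreover have "k \<noteq> 0"
    using cpr \<open>V \<noteq> {}\<close> unfolding cross_polytope_retraction_def by auto
  ultimately obtain n where "cross_polytope_retraction A V (Suc n) c b e"
    using not0_implies_Suc by blast
  then have "\<not> contractible_space (geometric_realization (Ind V E))"
    using cross_polytope_retraction_not_contractible fin irr unfolding A_def by blast
  then show False using assms(3) unfolding contractible_complex_def by blast
qed

end
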